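(* Let $d\ge 3$ and $1\le a<b\le d-1$ be integers with $\gcd(a,b,d)=1$. Let $M=\mathrm{Circ}_{(d;0,a,b)}$ be the $d\times d$ three-lines circulant matrix with entries in $\mathbb{Z}[x,y,z]$. Then for any nonnegative integers $A,B$ with $A+B\le d$: (1) $[\det(M)]_{d-A-B,A,B}\ne 0$ if and only if $d\mid (aA+bB)$. Further, assuming $d\mid (aA+bB)$: (2) the sign of $[\det(M)]_{d-A-B,A,B}$ is $+$ if and only if at least one of the integers $\gcd\left(A,B,\frac{aA+bB}{d}\right)$ and $A+B-1$ is even; (3) the absolute value of $[\det(M)]_{d-A-B,A,B}$ equals the number of permutations of $\{0,1,\dots,d-1\}$ whose decomposition into disjoint nontrivial cycles (all remaining elements being fixed points) has the form $C_1\circ C_2\circ\cdots\circ C_k$, where $k=\gcd\left(A,B,\frac{aA+bB}{d}\right)$, and each $C_i$ has length $\frac{A+B}{k}$ and consists of exactly $\frac{A}{k}$ elements $j$ with $C_i(j)\equiv j+a \pmod d$ and exactly $\frac{B}{k}$ elements $j$ with $C_i(j)\equiv j+b\pmod d$.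
   Context: For integers $d\ge 3$ and $1\le a<b\le d-1$, $\mathrm{Circ}_{(d;0,a,b)}$ is the $d\times d$ matrix with rows and columns indexed by $0,\dots,d-1$ whose $(i,j)$ entry is $x$ if $j-i\equiv 0 \pmod d$, $y$ if $j-i\equiv a\pmod d$, $z$ if $j-i\equiv b\pmod d$, and $0$ otherwise, where $x,y,z$ are indeterminates. For a polynomial $F\in\mathbb{Z}[x,y,z]$, $[F]_{i,j,k}$ denotes the coefficient of $x^iy^jz^k$ in $F$. Convention: $\gcd(0,0,0)=0$; in the case $A=B=0$ one has $k=0$ and the only permutation counted in (3) is the identity (no nontrivial cycles). *)

theory Defs
  imports
    "HOL-Library.Poly_Mapping"
    "HOL-Number_Theory.Cong"
    "HOL-Combinatorics.Cycles"
    "Jordan_Normal_Form.Determinant"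
begin

datatype indet = Ix | Iy | Iz

text \<open>Monomials are the finitely supported exponent functions, so this is $\mathbb{Z}[x,y,z]$.\<close>

type_synonym poly_xyz = "(indet \<Rightarrow>\<^sub>0 nat) \<Rightarrow>\<^sub>0 int"

definition indeterminate :: "indet \<Rightarrow> poly_xyz" where
  "indeterminate v = Poly_Mapping.single (Poly_Mapping.single v 1) 1"

definition coeff_xyz :: "poly_xyz \<Rightarrow> nat \<Rightarrow> nat \<Rightarrow> nat \<Rightarrow> int" where
  "coeff_xyz F i j k =
     Poly_Mapping.lookup F
       (Poly_Mapping.single Ix i + Poly_Mapping.single Iy j + Poly_Mapping.single Iz k)"

definition Circ :: "nat \<Rightarrow> nat \<Rightarrow> nat \<Rightarrow> poly_xyz mat" where
  "Circ d a b = mat d d (\<lambda>(i, j).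
     if [int j - int i = 0] (mod int d) then indeterminate Ix
     else if [int j - int i = int a] (mod int d) then indeterminate Iy
     else if [int j - int i = int b] (mod int d) then indeterminate Iz
     else 0)"

text \<open>A nontrivial cycle is given by the list of its elements in cyclic order; disjointness of
  the cycles in \<open>css\<close> is part of \<open>distinct (concat css)\<close>.\<close>

definition disjoint_cycle_decomposition :: "(nat \<Rightarrow> nat) \<Rightarrow> nat list list \<Rightarrow> bool" where
  "disjoint_cycle_decomposition p css \<longleftrightarrow>
     (\<forall>cs \<in> set css. length cs \<ge> 2) \<and>
     distinct (concat css) \<and>
     p = foldr (\<circ>) (map cycle_of_list css) id"

text \<open>The exact divisions by \<open>k\<close> below are natural-number divisions; if \<open>k = 0\<close> then
  \<open>css\<close> is empty and only the identity qualifies.\<close>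

definition balanced_perms :: "nat \<Rightarrow> nat \<Rightarrow> nat \<Rightarrow> nat \<Rightarrow> nat \<Rightarrow> nat \<Rightarrow> (nat \<Rightarrow> nat) set" where
  "balanced_perms d a b A B k =
     {p. p permutes {0..<d} \<and>
         (\<exists>css. disjoint_cycle_decomposition p css \<and> length css = k \<and>
            (\<forall>cs \<in> set css.
               length cs = (A + B) div k \<and>
               card {j \<in> set cs. [cycle_of_list cs j = j + a] (mod d)} = A div k \<and>
               card {j \<in> set cs. [cycle_of_list cs j = j + b] (mod d)} = B div k))}"

end

theory Submission
  imports Defs
begin

text \<open>The coefficient is the sum of the signs of the permutations of \<open>\<int>/d\<close> that move \<open>A\<close> points by
  \<open>a\<close>, \<open>B\<close> points by \<open>b\<close>, and fix the rest. Since \<open>a\<close> and \<open>b\<close> generate \<open>\<int>/d\<close>, the nontrivial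
  cycles of such a permutation lift to vertex-disjoint lattice paths in \<open>\<int>\<^sup>2\<close> with unit east and north
  steps, periodic under the lattice \<open>{(u, v). d dvd a u + b v}\<close>. Disjoint paths cannot cross, so all
  cycles have the same displacement, and this displacement is primitive in the lattice. Hence there
  are exactly \<open>gcd(A, B, (a A + b B)/d)\<close> cycles of equal type, all contributing permutations have the
  same sign, and no cancellation occurs. When \<open>d\<close> divides \<open>a A + b B\<close>, an interval exchange
  yields a contributing permutation.\<close>

subsection \<open>Noncrossing of the lifted orbits\<close>

lemma not_cong_add_both:
  fixes a b d x j :: nat
  assumes "a < b" "b < d"
  shows "\<not> ([x = j + a] (mod d) \<and> [x = j + b] (mod d))"
proof
  assume "[x = j + a] (mod d) \<and> [x = j + b] (mod d)"
  then have "[j + a = j + b] (mod d)" by (meson cong_sym cong_trans)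
  then have "[a = b] (mod d)" by (simp add: cong_add_lcancel_nat)
  then have "a = b" using assms by (intro cong_less_modulus_unique_nat[of a b d]) auto
  then show False using assms(1) by simp
qed

text \<open>\<open>a\<close> and \<open>b\<close> generate the integers modulo \<open>d\<close>. The
  coefficients serve twice: to lift residues to lattice points, and to build a character with
  prescribed values at \<open>a\<close> and \<open>b\<close>.\<close>

lemma bezout_mod:
  assumes "gcd a (gcd b d) = (1 :: nat)"
  obtains u v w where "1 = u * int a + v * int b + int d * w"
proof -
  obtain r s where rs: "r * int b + s * int d = gcd (int b) (int d)"
    by (metis bezout_int)
  obtain u v where uv: "u * int a + v * gcd (int b) (int d) = gcd (int a) (gcd (int b) (int d))"
    by (metis bezout_int)
  have "gcd (int a) (gcd (int b) (int d)) = 1"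
    using assms by (metis gcd_int_int_eq of_nat_1)
  with uv have "1 = u * int a + v * (r * int b + s * int d)"
    by (simp only: rs)
  then have "1 = u * int a + (v * r) * int b + int d * (v * s)"
    by (simp add: algebra_simps)
  then show ?thesis by (rule that)
qed

text \<open>The numbers of \<open>a\<close> and \<open>b\<close> steps are left open, since the
  locale is also interpreted for permutations whose counts are established only afterwards.\<close>

locale three_line_perm =
  fixes d a b :: nat and p :: "nat \<Rightarrow> nat"
  assumes a_pos: "1 \<le> a" and a_less_b: "a < b" and b_less_d: "b < d"
    and coprime_steps: "gcd a (gcd b d) = 1"
    and permutes: "p permutes {0..<d}"
    and steps: "\<And>i. i < d \<Longrightarrow> p i \<noteq> i \<Longrightarrow> [p i = i + a] (mod d) \<or> [p i = i + b] (mod d)"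
begin

section \<open>Lifting orbits to lattice paths\<close>

definition astep :: "nat \<Rightarrow> int" where
  "astep x = of_bool [p x = x + a] (mod d)"

text \<open>For a moved point \<open>x\<close> the lifted path is displaced by
  \<open>(asteps m x, m - asteps m x)\<close> after \<open>m\<close> steps, so this number alone
  locates it on its antidiagonal.\<close>

definition asteps :: "nat \<Rightarrow> nat \<Rightarrow> int" where
  "asteps m x = (\<Sum>i<m. astep ((p ^^ i) x))"

lemma asteps_0 [simp]: "asteps 0 x = 0"
  by (simp add: asteps_def)

lemma asteps_Suc: "asteps (Suc m) x = astep x + asteps m (p x)"
  unfolding asteps_def sum.lessThan_Suc_shift by (simp add: funpow_swap1)

lemma asteps_add: "asteps (n + m) x = asteps n x + asteps m ((p ^^ n) x)"
  by (induction n arbitrary: x) (simp_all add: asteps_Suc funpow_swap1)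

lemma inj_p: "inj p"
  using permutes by (rule permutes_inj)

lemma p_less: "x < d \<Longrightarrow> p x < d"
  using permutes_in_image[OF permutes, of x] by simp

lemma funpow_less: "x < d \<Longrightarrow> (p ^^ n) x < d"
  by (induction n) (simp_all add: p_less)

lemma p_moved: "p x \<noteq> x \<Longrightarrow> p (p x) \<noteq> p x"
  using inj_p by (simp add: inj_eq)

lemma funpow_moved: "p x \<noteq> x \<Longrightarrow> p ((p ^^ n) x) \<noteq> (p ^^ n) x"
  by (induction n) (simp_all add: p_moved)

text \<open>Every step is counted as \<open>b\<close>, with correction \<open>a - b\<close> when it
  is an \<open>a\<close> step. In this form simultaneous steps on two paths change their difference
  only by a multiple of \<open>a - b\<close>.\<close>

lemma step_cong:
  assumes "x < d" "p x \<noteq> x"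
  shows "[int (p x) = int x + int b + astep x * (int a - int b)] (mod int d)"
proof (cases "[p x = x + a] (mod d)")
  case True
  then have "[int (p x) = int x + int a] (mod int d)"
    by (metis cong_int_iff of_nat_add)
  with True show ?thesis by (simp add: astep_def)
next
  case False
  with steps[OF assms] have "[p x = x + b] (mod d)" by simp
  then have "[int (p x) = int x + int b] (mod int d)"
    by (metis cong_int_iff of_nat_add)
  with False show ?thesis by (simp add: astep_def)
qed

lemma funpow_cong:
  assumes "x < d" "p x \<noteq> x"
  shows "[int ((p ^^ n) x) = int x + int n * int b + asteps n x * (int a - int b)] (mod int d)"
  using assms
proof (induction n arbitrary: x)
  case 0
  then show ?case by simp
next
  case (Suc n)
  have "[int ((p ^^ n) (p x)) = int (p x) + int n * int b + asteps n (p x) * (int a - int b)] (mod int d)"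
    using Suc.prems by (intro Suc.IH p_less p_moved)
  also have "[int (p x) + int n * int b + asteps n (p x) * (int a - int b) =
      int x + int b + astep x * (int a - int b) + int n * int b + asteps n (p x) * (int a - int b)] (mod int d)"
    by (intro cong_add step_cong Suc.prems cong_refl)
  finally show ?case
    by (simp add: funpow_swap1 asteps_Suc algebra_simps)
qed

lemma eq_if_cong: "x < d \<Longrightarrow> y < d \<Longrightarrow> [int x = int y] (mod int d) \<Longrightarrow> x = y"
  by (simp add: cong_int_iff cong_less_modulus_unique_nat)

text \<open>Lift the orbits to \<open>\<int>\<^sup>2\<close>, where every moved point makes a unit step east (for
  \<open>a\<close>) or north (for \<open>b\<close>); \<open>t\<close> is the oriented distance of two lattice paths along a common
  antidiagonal, and vertex-disjoint paths cannot cross.\<close>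

lemma noncrossing:
  assumes "x < d" "y < d" "p x \<noteq> x" "p y \<noteq> y" "t > 0"
    and "[int y = int x + t * (int a - int b)] (mod int d)"
  shows "t + asteps m y - asteps m x > 0"
  using assms
proof (induction m arbitrary: x y t)
  case 0
  then show ?case by simp
next
  case (Suc m)
  define t' where "t' = t + astep y - astep x"
  have "[int (p y) = int y + int b + astep y * (int a - int b)] (mod int d)"
    by (intro step_cong Suc.prems)
  also have "[int y + int b + astep y * (int a - int b) =
      int x + t * (int a - int b) + int b + astep y * (int a - int b)] (mod int d)"
    by (intro cong_add Suc.prems cong_refl)
  also have "int x + t * (int a - int b) + int b + astep y * (int a - int b) =
      int x + int b + astep x * (int a - int b) + t' * (int a - int b)"
    by (simp add: t'_def algebra_simps)
  also have "[\<dots> = int (p x) + t' * (int a - int b)] (mod int d)"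
    by (intro cong_add cong_refl cong_sym[OF step_cong] Suc.prems)
  finally have c: "[int (p y) = int (p x) + t' * (int a - int b)] (mod int d)" .
  \<comment> \<open>One step changes the distance by at most 1, so it could only drop to 0. The two
    paths would then meet after different steps, against injectivity of \<open>p\<close>.\<close>
  have "t' > 0"
  proof (rule ccontr)
    assume "\<not> t' > 0"
    moreover have "astep x \<in> {0, 1}" "astep y \<in> {0, 1}"
      by (simp_all add: astep_def)
    ultimately have *: "t' = 0" "astep x \<noteq> astep y"
      using \<open>t > 0\<close> by (auto simp: t'_def)
    with c have "p y = p x"
      using Suc.prems by (auto intro!: eq_if_cong p_less)
    then have "y = x"
      using inj_p by (simp add: inj_eq)
    with * show False by simp
  qed
  then have "t' + asteps m (p y) - asteps m (p x) > 0"
    using Suc.prems c by (intro Suc.IH p_less p_moved)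
  then show ?case
    by (simp add: t'_def asteps_Suc)
qed

section \<open>Periods and slopes of closed paths\<close>

lemma asteps_period_mult: "(p ^^ l) x = x \<Longrightarrow> asteps (l * N) x = int N * asteps l x"
  by (induction N) (simp_all add: asteps_add algebra_simps)

lemma asteps_period_shift:
  assumes "(p ^^ l) x = x"
  shows "asteps l ((p ^^ n) x) = asteps l x"
proof -
  have "asteps (n + l) x = asteps (l + n) x" by (simp add: add.commute)
  then show ?thesis by (simp only: asteps_add assms)
qed

lemma funpow_period_shift:
  assumes "(p ^^ l) x = x"
  shows "(p ^^ l) ((p ^^ n) x) = (p ^^ n) x"
  by (metis assms add.commute comp_apply funpow_add)

text \<open>Brings two arbitrary orbits into the position that \<open>noncrossing\<close>
  compares.\<close>

lemma common_antidiagonal: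
  assumes "x < d" "p x \<noteq> x"
  obtains n t where "t > 0" "[int y = int ((p ^^ n) x) + t * (int a - int b)] (mod int d)"
proof -
  obtain u v w where bez: "1 = u * int a + v * int b + int d * w"
    using bezout_mod[OF coprime_steps] .
  define D where "D = int y - int x"
  \<comment> \<open>The lattice point \<open>(D * u, D * v)\<close> lies over the residue
    \<open>D\<close>, on the antidiagonal \<open>D * (u + v)\<close>. Only the class of this index
    modulo \<open>d\<close> matters, so a natural representative is taken.\<close>
  define n where "n = nat ((D * (u + v)) mod int d)"
  have d0: "int d > 0" using assms(1) by simp
  have n: "[int n = D * (u + v)] (mod int d)"
    using d0 by (simp add: n_def)
  \<comment> \<open>The distance also matters only modulo \<open>d\<close>; adding
    \<open>int d\<close> to the remainder makes it positive.\<close>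
  define t where "t = (D * u - asteps n x) mod int d + int d"
  have t: "[t = D * u - asteps n x] (mod int d)"
    by (simp add: t_def cong_def)
  have "[int ((p ^^ n) x) + t * (int a - int b) =
      (int x + int n * int b + asteps n x * (int a - int b)) + (D * u - asteps n x) * (int a - int b)] (mod int d)"
    by (intro cong_add funpow_cong assms cong_mult t cong_refl)
  also have "(int x + int n * int b + asteps n x * (int a - int b)) + (D * u - asteps n x) * (int a - int b)
     = int x + int n * int b + D * u * (int a - int b)" by (simp add: algebra_simps)
  also have "[\<dots> = int x + (D * (u + v)) * int b + D * u * (int a - int b)] (mod int d)"
    by (intro cong_add cong_mult n cong_refl)
  also have "int x + (D * (u + v)) * int b + D * u * (int a - int b)
      = int x + D * (u * int a + v * int b)" by (simp add: algebra_simps)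
  also have "\<dots> = int x + D * (1 - int d * w)" using bez by simp
  also have "\<dots> = int y + int d * (- D * w)" by (simp add: D_def algebra_simps)
  also have "[\<dots> = int y] (mod int d)" by (simp only: cong_def mod_mult_self2)
  finally have "[int y = int ((p ^^ n) x) + t * (int a - int b)] (mod int d)"
    by (rule cong_sym)
  moreover have "t > 0" using d0 by (simp add: t_def add_nonneg_pos)
  ultimately show ?thesis by (rule that[rotated])
qed

text \<open>After \<open>l * k * N\<close> steps both paths have completed whole periods, and their
  distance is \<open>t + N * (int l * asteps k y - int k * asteps l x)\<close>. A negative bracket
  would make this nonpositive already for \<open>N = nat t\<close>, so the paths would have
  crossed.\<close>

lemma slope_le:
  assumes "x < d" "y < d" "p x \<noteq> x" "p y \<noteq> y" "(p ^^ l) x = x" "(p ^^ k) y = y"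
  shows "int k * asteps l x \<le> int l * asteps k y"
proof (rule ccontr)
  assume less: "\<not> ?thesis"
  obtain n t where nt: "t > 0" "[int y = int ((p ^^ n) x) + t * (int a - int b)] (mod int d)"
    using common_antidiagonal[OF assms(1,3)] by blast
  let ?z = "(p ^^ n) x"
  have "t + asteps (l * k * nat t) y - asteps (l * k * nat t) ?z > 0"
    using assms nt by (intro noncrossing funpow_less funpow_moved)
  moreover have "asteps (l * k * nat t) y = int (l * nat t) * asteps k y"
    using asteps_period_mult[OF assms(6), of "l * nat t"] by (simp add: ac_simps)
  moreover have "asteps (l * k * nat t) ?z = int (k * nat t) * asteps l x"
    using asteps_period_mult[OF funpow_period_shift[OF assms(5)], of "k * nat t" n]
    by (simp add: ac_simps asteps_period_shift[OF assms(5)])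
  ultimately have "t + t * (int l * asteps k y - int k * asteps l x) > 0"
    using nt(1) by (simp add: algebra_simps)
  moreover have "t * (int l * asteps k y - int k * asteps l x) \<le> t * (-1)"
    using less nt(1) by (intro mult_left_mono) auto
  ultimately show False by simp
qed

lemma slope_eq:
  assumes "x < d" "y < d" "p x \<noteq> x" "p y \<noteq> y" "(p ^^ l) x = x" "(p ^^ k) y = y"
  shows "int k * asteps l x = int l * asteps k y"
  using slope_le[OF assms] slope_le[of y x, OF assms(2,1,4,3,6,5)] by simp

text \<open>A lattice path that differs from its translate by a vector parallel to its own period would
  drift away from itself monotonically, contradicting the period.\<close>

lemma parallel_translation_is_period:
  assumes "x < d" "p x \<noteq> x" "(p ^^ l) x = x" "l > 0"
    and u: "u * int l = asteps l x * int n"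
    and closed: "[int n * int b + u * (int a - int b) = 0] (mod int d)"
  shows "(p ^^ n) x = x"
proof -
  let ?y = "(p ^^ n) x"
  \<comment> \<open>By \<open>closed\<close>, translating the path by \<open>(u, n - u)\<close>
    gives another lift of the same orbit. \<open>t\<close> is the signed distance from that
    translate to the path after \<open>n\<close> steps.\<close>
  define t where "t = asteps n x - u"
  have y: "?y < d" "p ?y \<noteq> ?y" by (intro funpow_less funpow_moved assms)+
  have "[int ?y = int x + int n * int b + asteps n x * (int a - int b)] (mod int d)"
    by (intro funpow_cong assms)
  also have "int x + int n * int b + asteps n x * (int a - int b) =
      int x + t * (int a - int b) + (int n * int b + u * (int a - int b))"
    by (simp add: t_def algebra_simps)
  also have "[\<dots> = int x + t * (int a - int b) + 0] (mod int d)"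
    by (intro cong_add cong_refl closed)
  finally have c: "[int ?y = int x + t * (int a - int b)] (mod int d)" by simp
  then have "[int ?y - t * (int a - int b) = int x + t * (int a - int b) - t * (int a - int b)] (mod int d)"
    by (intro cong_diff cong_refl)
  then have c': "[int x = int ?y + (- t) * (int a - int b)] (mod int d)"
    by (simp add: cong_sym)
  \<comment> \<open>The excess over \<open>u\<close> of the \<open>n\<close> steps begun at time
    \<open>m\<close> equals the distance between path and translate at that time.\<close>
  have drift: "asteps (m + n) x - asteps m x - u = t + asteps m ?y - asteps m x" for m
    unfolding add.commute[of m n] asteps_add by (simp add: t_def)
  \<comment> \<open>The same \<open>n * l\<close> steps form \<open>n\<close> full periods and also
    \<open>l\<close> blocks of \<open>n\<close> steps.\<close>
  have total: "asteps (n * l) x = u * int l"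
    using asteps_period_mult[OF assms(3), of n] u by (simp add: ac_simps)
  consider "t = 0" | "t > 0" | "t < 0" by linarith
  then show ?thesis
  proof cases
    case 1
    with c show ?thesis using y assms by (intro eq_if_cong) auto
  next
    case 2
    \<comment> \<open>The distance stays at least 1, so each block of \<open>n\<close> steps gains
      at least 1 over \<open>u\<close>; after \<open>l\<close> blocks this contradicts
      \<open>total\<close>. The case \<open>t < 0\<close> is the mirror image, with the two paths
      exchanged.\<close>
    have "asteps (n * N) x \<ge> u * int N + int N" for N
    proof (induction N)
      case (Suc N)
      have "t + asteps (n * N) ?y - asteps (n * N) x > 0"
        using 2 c y assms by (intro noncrossing)
      with Suc drift[of "n * N"] show ?case by (simp add: algebra_simps)
    qed simp
    from this[of l] total \<open>l > 0\<close> show ?thesis by simp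
  next
    case 3
    have "asteps (n * N) x \<le> u * int N - int N" for N
    proof (induction N)
      case (Suc N)
      have "- t + asteps (n * N) x - asteps (n * N) ?y > 0"
        using 3 c' y assms by (intro noncrossing) auto
      with Suc drift[of "n * N"] show ?case by (simp add: algebra_simps)
    qed simp
    from this[of l] total \<open>l > 0\<close> show ?thesis by simp
  qed
qed

end

subsection \<open>Disjoint cycle decompositions\<close>

lemma funpow_cycle_of_list_nth:
  assumes "distinct cs" "i < length cs"
  shows "(cycle_of_list cs ^^ n) (cs ! i) = cs ! ((i + n) mod length cs)"
proof -
  have "(cycle_of_list cs ^^ n) (cs ! i) = map (cycle_of_list cs ^^ n) cs ! i"
    using assms by simp
  also have "\<dots> = cs ! ((i + n) mod length cs)"
    using assms by (simp add: cyclic_rotation nth_rotate add.commute)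
  finally show ?thesis .
qed

lemma foldr_comp_Cons:
  "foldr (\<circ>) (map f (c # cs)) id = f c \<circ> foldr (\<circ>) (map f cs) id"
  by simp

lemma foldr_comp_Cons_apply:
  "foldr (\<circ>) (map f (c # cs)) id x = f c (foldr (\<circ>) (map f cs) id x)"
  by simp

lemma foldr_cycles_outside:
  assumes "x \<notin> set (concat css)"
  shows "foldr (\<circ>) (map cycle_of_list css) id x = x"
  using assms
proof (induction css)
  case (Cons c css)
  then have "x \<notin> set (concat css)" "x \<notin> set c" by simp_all
  with Cons.IH have "foldr (\<circ>) (map cycle_of_list css) id x = x" "x \<notin> set c" by blast+
  then show ?case unfolding foldr_comp_Cons_apply by (metis id_outside_supp)
qed simp

text \<open>The image of \<open>x\<close> stays in \<open>set cs\<close>, so by disjointness the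
  other factors fix both \<open>x\<close> and its image; the place of \<open>cs\<close> in the
  product does not matter.\<close>

lemma foldr_cycles_inside:
  assumes "distinct (concat css)" "cs \<in> set css" "x \<in> set cs"
  shows "foldr (\<circ>) (map cycle_of_list css) id x = cycle_of_list cs x"
  using assms
proof (induction css)
  case (Cons c css)
  show ?case
  proof (cases "x \<in> set c")
    case True
    with Cons.prems have "x \<notin> set (concat css)" by auto
    moreover from this have "cs = c" using Cons.prems by auto
    ultimately show ?thesis
      unfolding foldr_comp_Cons_apply by (metis foldr_cycles_outside)
  next
    case False
    with Cons.prems have cs: "cs \<in> set css" by auto
    then have "cycle_of_list cs x \<in> set cs"
      using permutes_in_image[OF cycle_permutes] Cons.prems(3) by fast
    then have "cycle_of_list cs x \<notin> set c"
      using Cons.prems cs by auto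
    moreover have "foldr (\<circ>) (map cycle_of_list css) id x = cycle_of_list cs x"
      using Cons.prems cs by (intro Cons.IH) simp_all
    ultimately show ?thesis
      unfolding foldr_comp_Cons_apply by (metis id_outside_supp)
  qed
qed simp

lemma disjoint_cycle_decomposition_outside:
  "disjoint_cycle_decomposition p css \<Longrightarrow> x \<notin> set (concat css) \<Longrightarrow> p x = x"
  unfolding disjoint_cycle_decomposition_def using foldr_cycles_outside by metis

lemma disjoint_cycle_decomposition_inside:
  "disjoint_cycle_decomposition p css \<Longrightarrow> cs \<in> set css \<Longrightarrow> x \<in> set cs \<Longrightarrow> p x = cycle_of_list cs x"
  unfolding disjoint_cycle_decomposition_def using foldr_cycles_inside by metis

lemma disjoint_cycle_decomposition_distinct:
  "disjoint_cycle_decomposition p css \<Longrightarrow> cs \<in> set css \<Longrightarrow> distinct cs"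
  unfolding disjoint_cycle_decomposition_def distinct_concat_iff by blast

text \<open>Turns questions about periods of \<open>p\<close> into index arithmetic modulo the
  length of the cycle.\<close>

lemma disjoint_cycle_decomposition_funpow:
  assumes "disjoint_cycle_decomposition p css" "cs \<in> set css" "i < length cs"
  shows "(p ^^ n) (cs ! i) = cs ! ((i + n) mod length cs)"
proof -
  note dist = disjoint_cycle_decomposition_distinct[OF assms(1,2)]
  have "(p ^^ n) (cs ! i) = (cycle_of_list cs ^^ n) (cs ! i)"
  proof (induction n)
    case (Suc n)
    have "(cycle_of_list cs ^^ n) (cs ! i) \<in> set cs"
      using assms(3) by (subst funpow_cycle_of_list_nth[OF dist]) (auto intro!: nth_mem mod_less_divisor)
    with Suc disjoint_cycle_decomposition_inside[OF assms(1,2)] show ?case by simp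
  qed simp
  then show ?thesis by (simp add: funpow_cycle_of_list_nth[OF dist assms(3)])
qed

lemma disjoint_cycle_decomposition_moved:
  assumes "disjoint_cycle_decomposition p css" "x \<in> set (concat css)"
  shows "p x \<noteq> x"
proof -
  obtain cs i where cs: "cs \<in> set css" "i < length cs" "x = cs ! i"
    using assms(2) by (metis UN_E in_set_conv_nth set_concat)
  have len: "length cs \<ge> 2"
    using assms(1) cs(1) by (simp add: disjoint_cycle_decomposition_def)
  have "(i + 1) mod length cs \<noteq> i"
    using len cs(2) by (cases "i + 1 = length cs") auto
  then have "cs ! ((i + 1) mod length cs) \<noteq> cs ! i"
    using disjoint_cycle_decomposition_distinct[OF assms(1) cs(1)] cs(2) len
    by (subst nth_eq_iff_index_eq) (auto intro!: mod_less_divisor)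
  then show ?thesis
    using disjoint_cycle_decomposition_funpow[OF assms(1) cs(1,2), of 1] cs(3) by simp
qed

text \<open>\<open>cycle_decomp\<close> also admits lists with fewer than two entries. They act as
  the identity and are dropped. The bound by \<open>S\<close> keeps each new cycle disjoint from the
  earlier ones in the induction.\<close>

lemma cycle_decomp_imp_disjoint_cycle_decomposition:
  assumes "cycle_decomp S p"
  shows "\<exists>css. disjoint_cycle_decomposition p css \<and> set (concat css) \<subseteq> S"
  using assms
proof induction
  case empty
  have "disjoint_cycle_decomposition id []"
    by (simp add: disjoint_cycle_decomposition_def)
  then show ?case by (intro exI[of _ "[]"]) (simp only: concat.simps list.set order_refl simp_thms)
next
  case (comp I p cs)
  then obtain css where css: "disjoint_cycle_decomposition p css" "set (concat css) \<subseteq> I"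
    by blast
  show ?case
  proof (cases "length cs \<ge> 2")
    case True
    have "set cs \<inter> set (concat css) = {}" using css(2) comp.hyps by blast
    with True css comp.hyps show ?thesis
      by (intro exI[of _ "cs # css"]) (auto simp: disjoint_cycle_decomposition_def)
  next
    case False
    then have "cycle_of_list cs = id" by (cases cs rule: cycle_of_list.cases) auto
    with css show ?thesis by (intro exI[of _ css]) auto
  qed
qed

lemma permutes_imp_disjoint_cycle_decomposition:
  assumes "p permutes S" "finite S"
  obtains css where "disjoint_cycle_decomposition p css"
  using cycle_decomp_imp_disjoint_cycle_decomposition[OF cycle_decomposition[OF assms]] by blast

lemma card_filter_concat:
  "distinct (concat css) \<Longrightarrow>
    card {x \<in> set (concat css). P x} = (\<Sum>cs\<leftarrow>css. card {x \<in> set cs. P x})"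
proof (induction css)
  case (Cons c css)
  have "{x \<in> set (concat (c # css)). P x} = {x \<in> set c. P x} \<union> {x \<in> set (concat css). P x}"
    by auto
  moreover have "card \<dots> = card {x \<in> set c. P x} + card {x \<in> set (concat css). P x}"
    using Cons.prems by (intro card_Un_disjoint) auto
  ultimately show ?case using Cons by simp
qed simp

section \<open>Signs of products of cycles\<close>

lemma sign_cycle_of_list:
  "distinct cs \<Longrightarrow> cs \<noteq> [] \<Longrightarrow> sign (cycle_of_list cs) = (-1) ^ (length cs - 1)"
  by (induction cs rule: cycle_of_list.induct)
    (auto simp: sign_compose permutation_swap_id permutation_of_cycle sign_swap_id)

lemma permutation_foldr_cycles: "permutation (foldr (\<circ>) (map cycle_of_list css) id)"
proof (induction css)
  case (Cons c css)
  then show ?case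
    unfolding foldr_comp_Cons by (rule permutation_compose[OF permutation_of_cycle])
qed simp

lemma sign_foldr_cycles:
  assumes "\<And>cs. cs \<in> set css \<Longrightarrow> distinct cs \<and> length cs = l" "l > 0"
  shows "sign (foldr (\<circ>) (map cycle_of_list css) id) = (-1) ^ ((l - 1) * length css)"
  using assms(1)
proof (induction css)
  case (Cons c css)
  have "sign (cycle_of_list c) = (-1) ^ (l - 1)"
    using Cons.prems[of c] \<open>l > 0\<close> sign_cycle_of_list[of c] by fastforce
  moreover have "sign (foldr (\<circ>) (map cycle_of_list css) id) = (-1) ^ ((l - 1) * length css)"
    by (rule Cons.IH) (simp add: Cons.prems)
  ultimately show ?case
    unfolding foldr_comp_Cons sign_compose[OF permutation_of_cycle permutation_foldr_cycles]
    by (simp only: length_Cons mult_Suc_right power_add)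
qed simp

subsection \<open>The common type of the cycles\<close>

context three_line_perm
begin

lemma not_a_and_b: "\<not> ([p j = j + a] (mod d) \<and> [p j = j + b] (mod d))"
  by (rule not_cong_add_both[OF a_less_b b_less_d])

lemma step_moves: "[p j = j + c] (mod d) \<Longrightarrow> 0 < c \<Longrightarrow> c < d \<Longrightarrow> p j \<noteq> j"
proof
  assume *: "[p j = j + c] (mod d)" "0 < c" "c < d" "p j = j"
  then have "[j + 0 = j + c] (mod d)" by simp
  then have "[0 = c] (mod d)" unfolding cong_add_lcancel_nat .
  then have "0 = c" using * by (intro cong_less_modulus_unique_nat[of 0 c d]) auto
  then show False using * by simp
qed

lemma moved_less: "p j \<noteq> j \<Longrightarrow> j < d"
  using permutes by (auto simp: permutes_def)

context
  fixes css
  assumes css: "disjoint_cycle_decomposition p css"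
begin

text \<open>A step by \<open>c\<close> with \<open>0 < c < d\<close> moves its point, so all points
  counted lie on the cycles.\<close>

lemma card_steps:
  assumes "0 < c" "c < d"
  shows "card {j \<in> {0..<d}. [p j = j + c] (mod d)} =
    (\<Sum>cs\<leftarrow>css. card {j \<in> set cs. [p j = j + c] (mod d)})"
proof -
  have "{j \<in> {0..<d}. [p j = j + c] (mod d)} = {j \<in> set (concat css). [p j = j + c] (mod d)}"
    using step_moves assms disjoint_cycle_decomposition_outside[OF css]
      disjoint_cycle_decomposition_moved[OF css] moved_less by fastforce
  moreover have "distinct (concat css)"
    using css unfolding disjoint_cycle_decomposition_def by blast
  ultimately show ?thesis by (simp only: card_filter_concat)
qed

lemma cycle_start:
  assumes "cs \<in> set css"
  shows "cs ! 0 < d" "p (cs ! 0) \<noteq> cs ! 0" "(p ^^ length cs) (cs ! 0) = cs ! 0" "length cs > 0"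
proof -
  have len: "length cs \<ge> 2"
    using css assms by (simp add: disjoint_cycle_decomposition_def)
  then show "length cs > 0" by linarith
  with assms have "cs ! 0 \<in> set (concat css)" by (metis UN_I nth_mem set_concat)
  then show "p (cs ! 0) \<noteq> cs ! 0" by (rule disjoint_cycle_decomposition_moved[OF css])
  then show "cs ! 0 < d" by (rule moved_less)
  show "(p ^^ length cs) (cs ! 0) = cs ! 0"
    using disjoint_cycle_decomposition_funpow[OF css assms \<open>length cs > 0\<close>, of "length cs"] by simp
qed

lemma period_dvd:
  assumes "cs \<in> set css" "(p ^^ n) (cs ! 0) = cs ! 0"
  shows "length cs dvd n"
proof -
  note len = cycle_start(4)[OF assms(1)]
  have "cs ! (n mod length cs) = cs ! 0"
    using disjoint_cycle_decomposition_funpow[OF css assms(1), of 0 n] len assms(2) by simp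
  then show ?thesis
    using disjoint_cycle_decomposition_distinct[OF css assms(1)] len
    by (subst (asm) nth_eq_iff_index_eq) (auto intro!: mod_less_divisor)
qed

text \<open>One turn from the base point \<open>cs ! 0\<close> visits each element of the cycle
  exactly once.\<close>

lemma asteps_cycle:
  assumes "cs \<in> set css"
  shows "asteps (length cs) (cs ! 0) = int (card {j \<in> set cs. [p j = j + a] (mod d)})"
proof -
  note dist = disjoint_cycle_decomposition_distinct[OF css assms]
  have "asteps (length cs) (cs ! 0) = (\<Sum>i<length cs. astep (cs ! i))"
    unfolding asteps_def
  proof (intro sum.cong refl arg_cong[of _ _ astep])
    fix i assume i: "i \<in> {..<length cs}"
    then have "0 < length cs" by (cases cs) auto
    from disjoint_cycle_decomposition_funpow[OF css assms this, of i] i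
    show "(p ^^ i) (cs ! 0) = cs ! i" by simp
  qed
  also have "\<dots> = sum astep (set cs)"
    using sum.reindex_bij_betw[OF bij_betw_nth[OF dist refl refl], of astep] .
  also have "\<dots> = int (card {j \<in> set cs. [p j = j + a] (mod d)})"
    by (simp add: astep_def sum_of_bool_eq Int_def)
  finally show ?thesis .
qed

lemma length_cycle:
  assumes "cs \<in> set css"
  shows "length cs = card {j \<in> set cs. [p j = j + a] (mod d)} + card {j \<in> set cs. [p j = j + b] (mod d)}"
proof -
  have "length cs = card (set cs)"
    using disjoint_cycle_decomposition_distinct[OF css assms] by (simp add: distinct_card)
  also have "set cs = {j \<in> set cs. [p j = j + a] (mod d)} \<union> {j \<in> set cs. [p j = j + b] (mod d)}"
    using assms disjoint_cycle_decomposition_moved[OF css] steps moved_less by fastforce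
  also have "card \<dots> = card {j \<in> set cs. [p j = j + a] (mod d)} + card {j \<in> set cs. [p j = j + b] (mod d)}"
    using not_a_and_b by (intro card_Un_disjoint) auto
  finally show ?thesis .
qed

text \<open>A full turn returns to its start, so its lattice displacement projects to 0 modulo
  \<open>d\<close>.\<close>

lemma cycle_closed:
  assumes "cs \<in> set css"
  shows "[int (length cs) * int b + asteps (length cs) (cs ! 0) * (int a - int b) = 0] (mod int d)"
proof -
  have "[int (cs ! 0) + 0 = int (cs ! 0) + (int (length cs) * int b + asteps (length cs) (cs ! 0) * (int a - int b))] (mod int d)"
    using funpow_cong[OF cycle_start(1,2)[OF assms], of "length cs"] cycle_start(3)[OF assms]
    by (simp add: add.assoc)
  then show ?thesis by (simp only: cong_add_lcancel cong_sym)
qed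

text \<open>By \<open>slope_eq\<close> the displacement of \<open>cs'\<close> is parallel to that of
  \<open>cs\<close>, hence its number of steps is a period of \<open>cs\<close> as well.\<close>

lemma length_dvd_length:
  assumes "cs \<in> set css" "cs' \<in> set css"
  shows "length cs dvd length cs'"
proof (rule period_dvd[OF assms(1)])
  show "(p ^^ length cs') (cs ! 0) = cs ! 0"
    using slope_eq[OF cycle_start(1)[OF assms(1)] cycle_start(1)[OF assms(2)] cycle_start(2)[OF assms(1)]
        cycle_start(2)[OF assms(2)] cycle_start(3)[OF assms(1)] cycle_start(3)[OF assms(2)]]
    by (intro parallel_translation_is_period[OF cycle_start[OF assms(1)] _ cycle_closed[OF assms(2)]])
      (simp add: mult.commute)
qed

lemma cycles_same_type:
  assumes "cs \<in> set css" "cs' \<in> set css"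
  shows "length cs = length cs'"
    and "card {j \<in> set cs. [p j = j + a] (mod d)} = card {j \<in> set cs'. [p j = j + a] (mod d)}"
proof -
  show len: "length cs = length cs'"
    by (intro dvd_antisym length_dvd_length assms)
  have "asteps (length cs) (cs ! 0) = asteps (length cs') (cs' ! 0)"
    using slope_eq[OF cycle_start(1)[OF assms(1)] cycle_start(1)[OF assms(2)] cycle_start(2)[OF assms(1)]
        cycle_start(2)[OF assms(2)] cycle_start(3)[OF assms(1)] cycle_start(3)[OF assms(2)]]
      cycle_start(4)[OF assms(2)] len by simp
  then show "card {j \<in> set cs. [p j = j + a] (mod d)} = card {j \<in> set cs'. [p j = j + a] (mod d)}"
    by (simp only: asteps_cycle assms of_nat_eq_iff)
qed

text \<open>All cycles share one displacement \<open>(u, v)\<close>, so the number \<open>N\<close>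
  of cycles satisfies \<open>A = N * u\<close> and \<open>B = N * v\<close>, and \<open>N\<close>
  divides \<open>k\<close>. Conversely \<open>(A div k, B div k)\<close> is a lattice vector
  parallel to \<open>(u, v)\<close>, hence a period of each cycle, which makes \<open>k\<close>
  divide \<open>N\<close>.\<close>

lemma cycle_type:
  fixes A B k
  defines "A \<equiv> card {j \<in> {0..<d}. [p j = j + a] (mod d)}"
    and "B \<equiv> card {j \<in> {0..<d}. [p j = j + b] (mod d)}"
    and "k \<equiv> gcd A (gcd B ((a * A + b * B) div d))"
  shows "length css = k"
    and "cs \<in> set css \<Longrightarrow> length cs = (A + B) div k"
    and "cs \<in> set css \<Longrightarrow> card {j \<in> set cs. [p j = j + a] (mod d)} = A div k"
    and "cs \<in> set css \<Longrightarrow> card {j \<in> set cs. [p j = j + b] (mod d)} = B div k"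
proof -
  have A: "A = (\<Sum>cs\<leftarrow>css. card {j \<in> set cs. [p j = j + a] (mod d)})"
    unfolding A_def using a_pos a_less_b b_less_d by (intro card_steps) auto
  have B: "B = (\<Sum>cs\<leftarrow>css. card {j \<in> set cs. [p j = j + b] (mod d)})"
    unfolding B_def using a_pos a_less_b b_less_d by (intro card_steps) auto
  have "length css = k \<and> (\<forall>cs \<in> set css. length cs = (A + B) div k \<and>
      card {j \<in> set cs. [p j = j + a] (mod d)} = A div k \<and>
      card {j \<in> set cs. [p j = j + b] (mod d)} = B div k)"
  proof (cases "css = []")
    case True
    \<comment> \<open>Without cycles \<open>A = B = 0\<close>, and \<open>k = 0\<close> because the
      gcd of zeros is 0.\<close>
    then show ?thesis using A B by (simp add: k_def)
  next
    case False
    then obtain c where c: "c \<in> set css" by fastforce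
    define l where "l = length c"
    define u where "u = card {j \<in> set c. [p j = j + a] (mod d)}"
    define v where "v = card {j \<in> set c. [p j = j + b] (mod d)}"
    have l: "l = u + v" "l > 0"
      using length_cycle[OF c] cycle_start(4)[OF c] by (simp_all add: l_def u_def v_def)
    have all: "length cs = l" "card {j \<in> set cs. [p j = j + a] (mod d)} = u"
      "card {j \<in> set cs. [p j = j + b] (mod d)} = v" if "cs \<in> set css" for cs
      using cycles_same_type[OF that c] length_cycle[OF that] l by (simp_all add: l_def u_def)
    let ?N = "length css"
    have "A = (\<Sum>cs\<leftarrow>css. u)" unfolding A by (intro arg_cong[of _ _ sum_list] map_cong refl all(2))
    then have Au: "A = ?N * u" by (simp add: sum_list_triv)
    have "B = (\<Sum>cs\<leftarrow>css. v)" unfolding B by (intro arg_cong[of _ _ sum_list] map_cong refl all(3))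
    then have Bv: "B = ?N * v" by (simp add: sum_list_triv)
    have ABl: "A + B = ?N * l" by (simp add: Au Bv l algebra_simps)
    have N0: "?N > 0" using False by simp
    have d0: "d > 0" using b_less_d by simp
    have "asteps l (c ! 0) = int u" unfolding l_def u_def by (rule asteps_cycle[OF c])
    then have "int (length c) * int b + asteps (length c) (c ! 0) * (int a - int b) = int (a * u + b * v)"
      unfolding l_def[symmetric] by (simp add: l(1) algebra_simps)
    then have "int d dvd int (a * u + b * v)"
      using cycle_closed[OF c] by (simp add: cong_0_iff)
    then have duv: "d dvd a * u + b * v" by (simp only: of_nat_dvd_iff)
    have uvN: "a * A + b * B = ?N * (a * u + b * v)" by (simp add: Au Bv algebra_simps)
    \<comment> \<open>Closedness of a single cycle lets the factor \<open>N\<close> pass through the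
      division, so \<open>N\<close> divides the third argument of the gcd too.\<close>
    have "(a * A + b * B) div d = ?N * ((a * u + b * v) div d)"
      unfolding uvN using duv by (simp add: div_mult_swap)
    then have Nk: "?N dvd k"
      unfolding k_def by (intro gcd_greatest) (simp_all add: Au Bv)
    have k0: "k > 0"
      using nat_0_less_mult_iff[of ?N l] N0 l(2) unfolding k_def ABl[symmetric] by auto
    have "k dvd A" "k dvd B" "k dvd (a * A + b * B) div d"
      unfolding k_def by (meson gcd_dvd1 gcd_dvd2 dvd_trans)+
    then obtain A' B' q' where k: "A = k * A'" "B = k * B'" "(a * A + b * B) div d = k * q'"
      by (elim dvdE)
    have "d dvd a * A + b * B" using duv uvN by simp
    then have "a * A + b * B = d * (k * q')" using k(3) by (metis dvd_mult_div_cancel)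
    then have "k * (a * A' + b * B') = k * (d * q')" by (simp add: k(1,2) algebra_simps)
    with k0 have q': "a * A' + b * B' = d * q'" by simp
    have "length c dvd A' + B'"
    proof (rule period_dvd[OF c])
      show "(p ^^ (A' + B')) (c ! 0) = c ! 0"
      proof (rule parallel_translation_is_period[OF cycle_start[OF c], of "int A'"])
        \<comment> \<open>Parallelism is checked after multiplication by \<open>N * k\<close>, where
          \<open>A\<close> and \<open>B\<close> can be written in both ways.\<close>
        have "?N * (k * (A' * l)) = (k * A') * (?N * l)" by simp
        also have "\<dots> = (?N * u) * (k * A' + k * B')" by (simp only: k(1,2)[symmetric] Au[symmetric] ABl)
        also have "\<dots> = ?N * (k * (u * (A' + B')))" by (simp add: algebra_simps)
        finally have "A' * l = u * (A' + B')" using N0 k0 by simp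
        then have "int A' * int l = int u * int (A' + B')" by (simp only: of_nat_mult[symmetric])
        then show "int A' * int (length c) = asteps (length c) (c ! 0) * int (A' + B')"
          by (simp only: asteps_cycle[OF c] l_def u_def)
        have "int (A' + B') * int b + int A' * (int a - int b) = int (a * A' + b * B')"
          by (simp add: algebra_simps)
        then show "[int (A' + B') * int b + int A' * (int a - int b) = 0] (mod int d)"
          unfolding q' by (simp add: cong_0_iff)
      qed
    qed
    then obtain m where "A' + B' = l * m" by (auto simp: l_def elim: dvdE)
    then have "k * A' + k * B' = (k * m) * l" by (metis distrib_left mult.assoc mult.commute)
    then have "?N * l = (k * m) * l" by (simp only: k(1,2)[symmetric] ABl)
    then have "?N = k * m" using l(2) by simp
    with Nk have Nk: "?N = k" by (metis dvd_antisym dvd_triv_left)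
    then show ?thesis using all Au Bv ABl k0 by simp
  qed
  then show "length css = k"
    and "cs \<in> set css \<Longrightarrow> length cs = (A + B) div k"
    and "cs \<in> set css \<Longrightarrow> card {j \<in> set cs. [p j = j + a] (mod d)} = A div k"
    and "cs \<in> set css \<Longrightarrow> card {j \<in> set cs. [p j = j + b] (mod d)} = B div k"
    by auto
qed

end

end

subsection \<open>Existence of contributing permutations\<close>

text \<open>With \<open>G = gcd C (int d)\<close>, multiplication by \<open>C\<close> takes each
  multiple of \<open>G\<close> modulo \<open>d\<close> exactly \<open>G\<close> times. An interval
  whose endpoints are multiples of \<open>G\<close> is therefore hit as often as its length.\<close>

lemma card_linear_residues:
  fixes C lo hi :: int and d :: nat
  assumes "d > 0" "0 \<le> lo" "lo \<le> hi" "hi \<le> int d"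
    and dvd: "gcd C (int d) dvd lo" "gcd C (int d) dvd hi"
  shows "card {j \<in> {0..<d}. lo \<le> (C * int j) mod int d \<and> (C * int j) mod int d < hi} = nat (hi - lo)"
proof -
  define G where "G = gcd C (int d)"
  define e where "e = int d div G"
  define \<rho> where "\<rho> j = (C * int j) mod int d" for j
  \<comment> \<open>The \<open>G\<close> indices sharing a value of \<open>\<rho>\<close> lie in
    different blocks of length \<open>e\<close>. Adding the block number spreads them over the gap
    up to the next multiple of \<open>G\<close>.\<close>
  define F where "F j = \<rho> j + int j div e" for j
  have G: "G > 0" "int d = G * e" using assms(1) by (simp_all add: G_def e_def)
  then have e: "e > 0" using assms(1) by (metis of_nat_0_less_iff zero_less_mult_pos)
  have \<rho>_dvd: "G dvd \<rho> j" for j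
    unfolding \<rho>_def by (simp add: G_def dvd_mod)
  have s_bound: "0 \<le> int j div e" "int j div e < G" if "j < d" for j
  proof -
    show "0 \<le> int j div e" using e by (simp add: pos_imp_zdiv_nonneg_iff)
    have "int j div e * e \<le> int j" using e by (simp add: div_mult_mod_eq minus_mod_eq_div_mult[symmetric])
    also have "\<dots> < G * e" using that G(2) by linarith
    finally show "int j div e < G" using e by simp
  qed
  have F_mod: "F j mod G = int j div e" if "j < d" for j
  proof -
    obtain z where "\<rho> j = G * z" using \<rho>_dvd[of j] by (rule dvdE)
    then have "F j mod G = (int j div e) mod G" by (simp add: F_def)
    then show ?thesis using s_bound[OF that] by simp
  qed
  \<comment> \<open>The added block number is less than \<open>G\<close>, so it never carries
    \<open>\<rho> j\<close> to or past the next multiple of \<open>G\<close>.\<close>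
  have F_iff: "x \<le> F j \<longleftrightarrow> x \<le> \<rho> j" if j: "j < d" and x: "G dvd x" for x j
  proof
    assume "x \<le> \<rho> j"
    then show "x \<le> F j" using s_bound(1)[OF j] by (simp add: F_def)
  next
    assume "x \<le> F j"
    obtain y z where yz: "x = G * y" "\<rho> j = G * z"
      using x \<rho>_dvd[of j] by (meson dvdE)
    have "G * y < G * z + G" using \<open>x \<le> F j\<close> s_bound(2)[OF j] by (simp add: F_def yz)
    then have "G * y < G * (z + 1)" by (simp add: distrib_left)
    then have "y < z + 1" using G(1) mult_less_cancel_left_pos by blast
    then show "x \<le> \<rho> j" using G(1) by (simp add: yz)
  qed
  have inj: "inj_on F {0..<d}"
  proof (rule inj_onI)
    fix i j assume ij: "i \<in> {0..<d}" "j \<in> {0..<d}" "F i = F j"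
    then have eq: "int i div e = int j div e" using F_mod[of i] F_mod[of j] by simp
    with ij have "\<rho> i = \<rho> j" by (simp add: F_def)
    then have "int d dvd C * (int i - int j)"
      unfolding \<rho>_def by (metis mod_eq_dvd_iff right_diff_distrib)
    then have "G * e dvd G * ((C div G) * (int i - int j))"
      by (simp add: G(2)[symmetric]) (simp add: G_def mult.assoc[symmetric])
    then have "e dvd (C div G) * (int i - int j)" using G(1) by simp
    moreover have "coprime e (C div G)"
      unfolding e_def G_def using assms(1) by (simp add: coprime_commute div_gcd_coprime)
    ultimately have "e dvd int i - int j" by (simp add: coprime_dvd_mult_right_iff)
    then have "int i mod e = int j mod e" by (simp add: mod_eq_dvd_iff)
    with eq have "int i = int j" by (metis mult_div_mod_eq)
    then show "i = j" by simp
  qed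
  have "F ` {0..<d} \<subseteq> {0..<int d}"
  proof safe
    fix j assume "j \<in> {0..<d}"
    then have j: "j < d" by simp
    have "0 \<le> \<rho> j" "\<not> int d \<le> \<rho> j" using assms(1) by (simp_all add: \<rho>_def not_le)
    then show "F j \<in> {0..<int d}"
      using F_iff[OF j, of "int d"] F_iff[OF j, of 0] by (simp add: G(2))
  qed
  then have image: "F ` {0..<d} = {0..<int d}"
    using inj by (intro card_subset_eq) (simp_all add: card_image)
  have "F ` {j \<in> {0..<d}. lo \<le> \<rho> j \<and> \<rho> j < hi} = {lo..<hi}"
  proof -
    have "F ` {j \<in> {0..<d}. lo \<le> \<rho> j \<and> \<rho> j < hi} = F ` {j \<in> {0..<d}. F j \<in> {lo..<hi}}"
      using F_iff dvd by (intro arg_cong[of _ _ "image F"]) (auto simp: G_def not_le[symmetric])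
    also have "\<dots> = F ` {0..<d} \<inter> {lo..<hi}" by auto
    also have "\<dots> = {lo..<hi}" using assms unfolding image by auto
    finally show ?thesis .
  qed
  moreover have "card (F ` {j \<in> {0..<d}. lo \<le> \<rho> j \<and> \<rho> j < hi}) = card {j \<in> {0..<d}. lo \<le> \<rho> j \<and> \<rho> j < hi}"
    using inj by (intro card_image) (auto intro: inj_on_subset)
  ultimately show ?thesis by (simp add: \<rho>_def)
qed

text \<open>The character \<open>j \<mapsto> C j\<close> with \<open>C a \<equiv> - B\<close> and \<open>C b \<equiv> A\<close> turns the permutation into the
  exchange of the intervals \<open>[0, B)\<close> and \<open>[B, A + B)\<close>.\<close>

lemma three_line_perm_exists:
  fixes a b d A B :: nat
  assumes ab: "1 \<le> a" "a < b" "b < d" and coprime: "gcd a (gcd b d) = 1"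
    and AB: "A + B \<le> d" and dvd: "d dvd a * A + b * B"
  obtains p where "three_line_perm d a b p"
    "card {j \<in> {0..<d}. [p j = j + a] (mod d)} = A"
    "card {j \<in> {0..<d}. [p j = j + b] (mod d)} = B"
proof -
  obtain u v w where bez: "1 = u * int a + v * int b + int d * w"
    using bezout_mod[OF coprime] .
  \<comment> \<open>The value is forced modulo \<open>d\<close>: it has to be
    \<open>u * (C * a) + v * (C * b)\<close>.\<close>
  define C where "C = int A * v - int B * u"
  define \<rho> where "\<rho> j = (C * int j) mod int d" for j
  have d0: "d > 0" using ab by simp
  obtain q where q: "int a * int A + int b * int B = int d * q"
    using dvd by (metis dvdE of_nat_add of_nat_dvd_iff of_nat_mult)
  have "C * int a = - int B * (u * int a) + (int a * int A) * v" by (simp add: C_def algebra_simps)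
  also have "\<dots> = - int B * (1 - v * int b - int d * w) + (int d * q - int b * int B) * v"
    using bez q by (intro arg_cong2[of _ _ _ _ "(+)"] arg_cong2[of _ _ _ _ "(*)"]) linarith+
  finally have Ca: "C * int a = - int B + int d * (v * q + int B * w)"
    by (simp add: algebra_simps)
  have "C * int b = int A * (v * int b) - (int b * int B) * u" by (simp add: C_def algebra_simps)
  also have "\<dots> = int A * (1 - u * int a - int d * w) - (int d * q - int a * int A) * u"
    using bez q by (intro arg_cong2[of _ _ _ _ "(-)"] arg_cong2[of _ _ _ _ "(*)"]) linarith+
  finally have Cb: "C * int b = int A + int d * (- u * q - int A * w)"
    by (simp add: algebra_simps)
  have \<rho>_bound: "0 \<le> \<rho> j" "\<rho> j < int d" for j using d0 by (simp_all add: \<rho>_def)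
  define p where "p j = (if j < d then if \<rho> j < int B then (j + b) mod d
      else if \<rho> j < int (A + B) then (j + a) mod d else j else j)" for j
  have \<rho>_mod: "\<rho> (j mod d) = \<rho> j" for j
    by (simp add: \<rho>_def of_nat_mod mod_mult_right_eq)
  have \<rho>_b: "\<rho> ((j + b) mod d) = \<rho> j + int A" if "\<rho> j < int B" for j
  proof -
    have "\<rho> (j + b) = (C * int j + C * int b) mod int d" by (simp add: \<rho>_def distrib_left)
    also have "\<dots> = (C * int j + int A) mod int d"
      unfolding Cb by (metis add.assoc mod_mult_self2)
    also have "\<dots> = (\<rho> j + int A) mod int d" by (simp add: \<rho>_def mod_add_left_eq)
    also have "\<dots> = \<rho> j + int A" using that \<rho>_bound[of j] AB by (intro mod_pos_pos_trivial) auto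
    finally show ?thesis by (simp add: \<rho>_mod)
  qed
  have \<rho>_a: "\<rho> ((j + a) mod d) = \<rho> j - int B" if "\<not> \<rho> j < int B" for j
  proof -
    have "\<rho> (j + a) = (C * int j + C * int a) mod int d" by (simp add: \<rho>_def distrib_left)
    also have "\<dots> = (C * int j - int B) mod int d"
      unfolding Ca by (metis add.assoc mod_mult_self2 uminus_add_conv_diff add.commute)
    also have "\<dots> = (\<rho> j - int B) mod int d" by (simp add: \<rho>_def mod_diff_left_eq)
    also have "\<dots> = \<rho> j - int B" using that \<rho>_bound[of j] by (intro mod_pos_pos_trivial) auto
    finally show ?thesis by (simp add: \<rho>_mod)
  qed
  have \<rho>_p: "\<rho> (p j) = (if \<rho> j < int B then \<rho> j + int A
      else if \<rho> j < int (A + B) then \<rho> j - int B else \<rho> j)" if "j < d" for j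
    using that by (simp add: p_def \<rho>_a \<rho>_b)
  have add_inj: "i = j" if "i < d" "j < d" "(i + c) mod d = (j + c) mod d" for i j c
  proof -
    have "[c + i = c + j] (mod d)" using that(3) by (simp add: cong_def add.commute)
    then have "[i = j] (mod d)" unfolding cong_add_lcancel_nat .
    then show ?thesis using that by (intro cong_less_modulus_unique_nat)
  qed
  have inj: "inj_on p {0..<d}"
  proof (rule inj_onI)
    fix i j assume ij: "i \<in> {0..<d}" "j \<in> {0..<d}" "p i = p j"
    \<comment> \<open>The interval exchange on residues is injective. Equal residues then put
      \<open>i\<close> and \<open>j\<close> into the same branch of \<open>p\<close>, which is a
      translation or the identity.\<close>
    then have eq: "\<rho> i = \<rho> j"
      using \<rho>_p[of i] \<rho>_p[of j] \<rho>_bound[of i] \<rho>_bound[of j] by (auto split: if_splits)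
    show "i = j" using ij add_inj[of i j] unfolding p_def eq by (auto split: if_splits)
  qed
  have range: "p ` {0..<d} \<subseteq> {0..<d}" using d0 by (auto simp: p_def)
  have "p permutes {0..<d}"
  proof (rule bij_imp_permutes)
    show "bij_betw p {0..<d} {0..<d}"
      using inj range endo_inj_surj by (metis bij_betw_def finite_atLeastLessThan)
  qed (simp add: p_def)
  then have perm: "three_line_perm d a b p"
    using ab coprime by unfold_locales (auto simp: p_def cong_def split: if_splits)
  interpret three_line_perm d a b p by (rule perm)
  have a_iff: "[p j = j + a] (mod d) \<longleftrightarrow> int B \<le> \<rho> j \<and> \<rho> j < int (A + B)"
    and b_iff: "[p j = j + b] (mod d) \<longleftrightarrow> 0 \<le> \<rho> j \<and> \<rho> j < int B" if "j < d" for j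
    using that not_a_and_b[of j] step_moves[of j a] step_moves[of j b] ab \<rho>_bound[of j]
    by (auto simp: p_def cong_def split: if_splits)
  \<comment> \<open>This makes the interval endpoints admissible for
    \<open>card_linear_residues\<close>.\<close>
  have G: "gcd C (int d) dvd int B" "gcd C (int d) dvd int A"
  proof -
    have "int B = int d * (v * q + int B * w) - C * int a" using Ca by simp
    moreover have "gcd C (int d) dvd int d * (v * q + int B * w) - C * int a"
      by (intro dvd_diff dvd_mult2) simp_all
    ultimately show "gcd C (int d) dvd int B" by simp
    have "int A = C * int b - int d * (- u * q - int A * w)" using Cb by simp
    moreover have "gcd C (int d) dvd C * int b - int d * (- u * q - int A * w)"
      by (intro dvd_diff dvd_mult2) simp_all
    ultimately show "gcd C (int d) dvd int A" by simp
  qed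
  have "{j \<in> {0..<d}. [p j = j + a] (mod d)} = {j \<in> {0..<d}. int B \<le> \<rho> j \<and> \<rho> j < int (A + B)}"
    using a_iff by auto
  then have "card {j \<in> {0..<d}. [p j = j + a] (mod d)} = A"
    using card_linear_residues[of d "int B" "int (A + B)" C] d0 AB G by (simp add: \<rho>_def)
  moreover have "{j \<in> {0..<d}. [p j = j + b] (mod d)} = {j \<in> {0..<d}. 0 \<le> \<rho> j \<and> \<rho> j < int B}"
    using b_iff by auto
  then have "card {j \<in> {0..<d}. [p j = j + b] (mod d)} = B"
    using card_linear_residues[of d 0 "int B" C] d0 AB G by (simp add: \<rho>_def)
  ultimately show ?thesis using perm by (intro that)
qed

subsection \<open>The coefficient as a signed count\<close>

text \<open>When \<open>1 \<le> a < b < d\<close> and \<open>A + B \<le> d\<close>, these are the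
  permutations that contribute to the coefficient in the Leibniz expansion.\<close>

definition three_line_perms :: "nat \<Rightarrow> nat \<Rightarrow> nat \<Rightarrow> nat \<Rightarrow> nat \<Rightarrow> (nat \<Rightarrow> nat) set" where
  "three_line_perms d a b A B = {p. p permutes {0..<d} \<and>
     (\<forall>i<d. p i \<noteq> i \<longrightarrow> [p i = i + a] (mod d) \<or> [p i = i + b] (mod d)) \<and>
     card {j \<in> {0..<d}. [p j = j + a] (mod d)} = A \<and>
     card {j \<in> {0..<d}. [p j = j + b] (mod d)} = B}"

lemma finite_three_line_perms: "finite (three_line_perms d a b A B)"
  by (rule finite_subset[OF _ finite_permutations[of "{0..<d}"]]) (auto simp: three_line_perms_def)

section \<open>Matrix entries and monomials\<close>

lemma cong_diff_nat_iff: "[int j - int i = int c] (mod int d) \<longleftrightarrow> [j = i + c] (mod d)"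
proof -
  have "[int j - int i = int c] (mod int d) \<longleftrightarrow> [int j = int (i + c)] (mod int d)"
    by (simp add: cong_iff_dvd_diff algebra_simps)
  then show ?thesis by (simp only: cong_int_iff)
qed

lemma Circ_index:
  assumes "i < d" "j < d"
  shows "Circ d a b $$ (i, j) =
    (if j = i then indeterminate Ix
     else if [j = i + a] (mod d) then indeterminate Iy
     else if [j = i + b] (mod d) then indeterminate Iz
     else 0)"
proof -
  have "[int j - int i = 0] (mod int d) \<longleftrightarrow> j = i"
    using assms cong_diff_nat_iff[of j i 0 d] cong_less_modulus_unique_nat[of j i d] by auto
  with assms show ?thesis by (simp add: Circ_def cong_diff_nat_iff)
qed

lemma prod_indeterminate:
  assumes "finite S"
  shows "(\<Prod>i\<in>S. indeterminate (f i)) =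
    Poly_Mapping.single (\<Sum>i\<in>S. Poly_Mapping.single (f i) 1) 1"
  using assms by (induction S) (simp_all add: indeterminate_def mult_single)

lemma lookup_sum_single:
  assumes "finite S"
  shows "Poly_Mapping.lookup (\<Sum>i\<in>S. Poly_Mapping.single (f i) (1 :: nat)) v = card {i \<in> S. f i = v}"
proof -
  have "Poly_Mapping.lookup (\<Sum>i\<in>S. Poly_Mapping.single (f i) (1 :: nat)) v = (\<Sum>i\<in>S. of_bool (f i = v))"
    by (auto simp: lookup_sum lookup_single when_def intro!: sum.cong)
  also have "\<dots> = card {i \<in> S. f i = v}"
    using assms by (simp add: sum_of_bool_eq Int_def)
  finally show ?thesis .
qed

text \<open>The product is a single monomial with coefficient 1, whose exponents are the sizes of
  the fibres of \<open>f\<close>.\<close>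

lemma coeff_xyz_prod_indeterminate:
  assumes "finite S"
  shows "coeff_xyz (\<Prod>i\<in>S. indeterminate (f i)) l m n =
    of_bool (card {i \<in> S. f i = Ix} = l \<and> card {i \<in> S. f i = Iy} = m \<and> card {i \<in> S. f i = Iz} = n)"
proof -
  have all: "(\<forall>v. P v) \<longleftrightarrow> P Ix \<and> P Iy \<and> P Iz" for P
    by (metis indet.exhaust)
  have "(\<Sum>i\<in>S. Poly_Mapping.single (f i) (1 :: nat)) =
      Poly_Mapping.single Ix l + Poly_Mapping.single Iy m + Poly_Mapping.single Iz n \<longleftrightarrow>
      (\<forall>v. card {i \<in> S. f i = v} =
        Poly_Mapping.lookup (Poly_Mapping.single Ix l + Poly_Mapping.single Iy m + Poly_Mapping.single Iz n) v)"
    unfolding poly_mapping_eq_iff fun_eq_iff lookup_sum_single[OF assms] ..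
  also have "\<dots> \<longleftrightarrow> card {i \<in> S. f i = Ix} = l \<and> card {i \<in> S. f i = Iy} = m \<and> card {i \<in> S. f i = Iz} = n"
    by (simp add: all lookup_add lookup_single)
  finally have eq: "(\<Sum>i\<in>S. Poly_Mapping.single (f i) (1 :: nat)) =
      Poly_Mapping.single Ix l + Poly_Mapping.single Iy m + Poly_Mapping.single Iz n \<longleftrightarrow>
      card {i \<in> S. f i = Ix} = l \<and> card {i \<in> S. f i = Iy} = m \<and> card {i \<in> S. f i = Iz} = n" .
  show ?thesis
    by (simp only: coeff_xyz_def prod_indeterminate[OF assms] lookup_single when_def of_bool_def eq)
qed

lemma coeff_xyz_signof_mult: "coeff_xyz (of_int (sign p) * F) l m n = sign p * coeff_xyz F l m n"
  by (cases p rule: sign_cases) (simp_all add: coeff_xyz_def)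

lemma coeff_xyz_sum: "coeff_xyz (sum F S) l m n = (\<Sum>x\<in>S. coeff_xyz (F x) l m n)"
  by (simp add: coeff_xyz_def lookup_sum)

section \<open>From the determinant to permutations\<close>

context
  fixes d a b A B :: nat
  assumes a_pos: "1 \<le> a" and a_less_b: "a < b" and b_less_d: "b < d"
    and coprime: "gcd a (gcd b d) = 1"
    and le: "A + B \<le> d"
begin

lemma coeff_prod_Circ:
  assumes p: "p permutes {0..<d}"
  shows "coeff_xyz (\<Prod>i = 0..<d. Circ d a b $$ (i, p i)) (d - A - B) A B =
    of_bool (p \<in> three_line_perms d a b A B)"
proof (cases "\<forall>i<d. p i \<noteq> i \<longrightarrow> [p i = i + a] (mod d) \<or> [p i = i + b] (mod d)")
  case True
  interpret three_line_perm d a b p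
    using a_pos a_less_b b_less_d coprime p True by unfold_locales auto
  define f where "f i = (if p i = i then Ix else if [p i = i + a] (mod d) then Iy else Iz)" for i
  have prod: "(\<Prod>i = 0..<d. Circ d a b $$ (i, p i)) = (\<Prod>i = 0..<d. indeterminate (f i))"
    using True p_less by (intro prod.cong) (auto simp: Circ_index f_def)
  have "{i \<in> {0..<d}. f i = Iy} = {j \<in> {0..<d}. [p j = j + a] (mod d)}"
    using step_moves[of _ a] a_pos a_less_b b_less_d by (auto simp: f_def)
  moreover have "{i \<in> {0..<d}. f i = Iz} = {j \<in> {0..<d}. [p j = j + b] (mod d)}"
    using step_moves[of _ b] not_a_and_b True a_less_b b_less_d by (auto simp: f_def)
  ultimately have mem: "p \<in> three_line_perms d a b A B \<longleftrightarrow>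
      card {i \<in> {0..<d}. f i = Iy} = A \<and> card {i \<in> {0..<d}. f i = Iz} = B"
    using p True by (simp only: three_line_perms_def mem_Collect_eq) blast
  \<comment> \<open>The total degree is \<open>d\<close>, so the exponents of \<open>Iy\<close> and
    \<open>Iz\<close> determine that of \<open>Ix\<close>.\<close>
  have total: "card {i \<in> {0..<d}. f i = Ix} + card {i \<in> {0..<d}. f i = Iy} + card {i \<in> {0..<d}. f i = Iz} = d"
  proof -
    let ?X = "{i \<in> {0..<d}. f i = Ix}" and ?Y = "{i \<in> {0..<d}. f i = Iy}" and ?Z = "{i \<in> {0..<d}. f i = Iz}"
    have "card {0..<d} = card (?X \<union> ?Y \<union> ?Z)"
      by (rule arg_cong[of _ _ card]) (use indet.exhaust in blast)
    also have "\<dots> = card (?X \<union> ?Y) + card ?Z" by (intro card_Un_disjoint) auto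
    also have "card (?X \<union> ?Y) = card ?X + card ?Y" by (intro card_Un_disjoint) auto
    finally show ?thesis by simp
  qed
  have "card {i \<in> {0..<d}. f i = Ix} = d - A - B \<and> card {i \<in> {0..<d}. f i = Iy} = A \<and>
      card {i \<in> {0..<d}. f i = Iz} = B \<longleftrightarrow> p \<in> three_line_perms d a b A B"
    unfolding mem using total le by linarith
  then show ?thesis
    unfolding prod by (simp only: coeff_xyz_prod_indeterminate[OF finite_atLeastLessThan])
next
  case False
  then obtain i where "i < d" "p i \<noteq> i" "\<not> [p i = i + a] (mod d)" "\<not> [p i = i + b] (mod d)"
    by blast
  moreover from this have "p i < d" using permutes_in_image[OF p, of i] by simp
  ultimately have "(\<Prod>i = 0..<d. Circ d a b $$ (i, p i)) = 0"
    by (intro prod_zero bexI[of _ i]) (auto simp: Circ_index)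
  then show ?thesis using False by (auto simp: coeff_xyz_def three_line_perms_def)
qed

lemma coeff_det_Circ:
  "coeff_xyz (det (Circ d a b)) (d - A - B) A B = (\<Sum>p\<in>three_line_perms d a b A B. sign p)"
proof -
  let ?P = "{p. p permutes {0..<d}}"
  have "Circ d a b \<in> carrier_mat d d" by (simp add: Circ_def)
  then have "coeff_xyz (det (Circ d a b)) (d - A - B) A B =
      (\<Sum>p\<in>?P. sign p * coeff_xyz (\<Prod>i = 0..<d. Circ d a b $$ (i, p i)) (d - A - B) A B)"
    by (simp only: det_def' coeff_xyz_sum coeff_xyz_signof_mult)
  also have "\<dots> = (\<Sum>p\<in>?P. if p \<in> three_line_perms d a b A B then sign p else 0)"
    by (intro sum.cong refl) (simp only: coeff_prod_Circ mem_Collect_eq, simp)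
  also have "\<dots> = (\<Sum>p\<in>?P \<inter> three_line_perms d a b A B. sign p)"
    by (simp add: sum.inter_restrict finite_permutations)
  also have "?P \<inter> three_line_perms d a b A B = three_line_perms d a b A B"
    by (auto simp: three_line_perms_def)
  finally show ?thesis .
qed

lemma three_line_permsD:
  assumes "p \<in> three_line_perms d a b A B"
  shows "three_line_perm d a b p"
  using assms a_pos a_less_b b_less_d coprime
  by unfold_locales (auto simp: three_line_perms_def)

text \<open>Divisibility suffices by the interval exchange. It is necessary because the
  displacements \<open>p j - j\<close> sum to 0, while modulo \<open>d\<close> they sum to
  \<open>a * A + b * B\<close>.\<close>

lemma three_line_perms_empty_iff:
  "three_line_perms d a b A B = {} \<longleftrightarrow> \<not> d dvd a * A + b * B"
proof
  show "\<not> d dvd a * A + b * B" if empty: "three_line_perms d a b A B = {}"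
  proof
    assume "d dvd a * A + b * B"
    then obtain p where p: "three_line_perm d a b p"
      "card {j \<in> {0..<d}. [p j = j + a] (mod d)} = A"
      "card {j \<in> {0..<d}. [p j = j + b] (mod d)} = B"
      using three_line_perm_exists[OF a_pos a_less_b b_less_d coprime le] by blast
    then have "p \<in> three_line_perms d a b A B"
      by (auto simp: three_line_perms_def three_line_perm_def)
    with empty show False by simp
  qed
  show "three_line_perms d a b A B = {}" if "\<not> d dvd a * A + b * B"
  proof (rule ccontr)
    assume "three_line_perms d a b A B \<noteq> {}"
    then obtain p where p: "p \<in> three_line_perms d a b A B" by blast
    interpret three_line_perm d a b p by (rule three_line_permsD[OF p])
    let ?f = "\<lambda>j. int a * of_bool [p j = j + a] (mod d) + int b * of_bool [p j = j + b] (mod d)"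
    have "[\<Sum>j\<in>{0..<d}. int (p j) = \<Sum>j\<in>{0..<d}. int j + ?f j] (mod int d)"
    proof (intro cong_sum)
      fix j assume "j \<in> {0..<d}"
      then have j: "j < d" by simp
      consider "p j = j" | "[p j = j + a] (mod d)" | "[p j = j + b] (mod d)"
        using steps[OF j] by blast
      then show "[int (p j) = int j + ?f j] (mod int d)"
      proof cases
        case 1
        then show ?thesis
          using step_moves[of j a] step_moves[of j b] a_pos a_less_b b_less_d by auto
      next
        case 2
        then have "[int (p j) = int j + int a] (mod int d)" by (metis cong_int_iff of_nat_add)
        with 2 not_a_and_b[of j] show ?thesis by simp
      next
        case 3
        then have "[int (p j) = int j + int b] (mod int d)" by (metis cong_int_iff of_nat_add)
        with 3 not_a_and_b[of j] show ?thesis by simp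
      qed
    qed
    moreover have "(\<Sum>j\<in>{0..<d}. int (p j)) = (\<Sum>j\<in>{0..<d}. int j)"
      by (rule sum.permute[OF permutes, unfolded comp_def, symmetric])
    moreover have "(\<Sum>j\<in>{0..<d}. ?f j) = int a * int A + int b * int B"
      using p unfolding sum.distrib sum_distrib_left[symmetric]
      by (simp add: sum_of_bool_eq three_line_perms_def Int_def)
    ultimately have "[(\<Sum>j\<in>{0..<d}. int j) + 0 = (\<Sum>j\<in>{0..<d}. int j) + int (a * A + b * B)] (mod int d)"
      by (simp add: sum.distrib)
    then have "int d dvd int (a * A + b * B)"
      unfolding cong_add_lcancel by (metis cong_0_iff cong_sym)
    with that show False by (simp only: of_nat_dvd_iff)
  qed
qed

text \<open>There are \<open>k\<close> cycles of length \<open>(A + B) div k\<close>, and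
  \<open>A + B - k\<close> has the parity of \<open>A + B + k\<close>. The sign is thus the same for
  all contributing permutations.\<close>

lemma sign_three_line_perm:
  assumes "p \<in> three_line_perms d a b A B"
  defines "k \<equiv> gcd A (gcd B ((a * A + b * B) div d))"
  shows "sign p = (-1) ^ (A + B + k)"
proof -
  interpret three_line_perm d a b p by (rule three_line_permsD[OF assms(1)])
  obtain css where css: "disjoint_cycle_decomposition p css"
    using permutes_imp_disjoint_cycle_decomposition[OF permutes] by blast
  have AB: "card {j \<in> {0..<d}. [p j = j + a] (mod d)} = A"
    "card {j \<in> {0..<d}. [p j = j + b] (mod d)} = B"
    using assms(1) by (simp_all add: three_line_perms_def)
  note type = cycle_type[OF css, unfolded AB, folded k_def]
  have p: "p = foldr (\<circ>) (map cycle_of_list css) id"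
    using css unfolding disjoint_cycle_decomposition_def by blast
  show ?thesis
  proof (cases "k = 0")
    case True
    then have "A = 0" "B = 0" by (simp_all add: k_def)
    moreover have "css = []" using type(1) True by simp
    ultimately show ?thesis using p True by simp
  next
    case False
    define l where "l = (A + B) div k"
    have "k dvd A + B" unfolding k_def by (meson dvd_add gcd_dvd1 gcd_dvd2 dvd_trans)
    then have kl: "A + B = l * k" by (simp add: l_def)
    moreover have "A + B > 0" using False by (auto simp: k_def intro!: Nat.gr0I)
    ultimately have "l > 0" by (cases l) auto
    have "sign (foldr (\<circ>) (map cycle_of_list css) id) = (-1) ^ ((l - 1) * length css)"
      using type(2) disjoint_cycle_decomposition_distinct[OF css] \<open>l > 0\<close>
      by (intro sign_foldr_cycles) (auto simp: l_def)
    then have "sign p = (-1) ^ ((l - 1) * k)" by (simp only: p[symmetric] type(1))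
    \<comment> \<open>Adding \<open>2 * k\<close> leaves the sign unchanged and avoids a truncated
      subtraction.\<close>
    also have "\<dots> = (-1) ^ ((l - 1) * k + 2 * k)" by (simp add: power_add)
    also have "(l - 1) * k + 2 * k = A + B + k"
      using \<open>l > 0\<close> unfolding kl by (cases l) simp_all
    finally show ?thesis .
  qed
qed

text \<open>\<open>cycle_type\<close> shows that a contributing permutation is balanced. Conversely,
  the counts on a balanced cycle add up to its length, which leaves no room for other steps.\<close>

lemma balanced_perms_eq:
  assumes dvd: "d dvd a * A + b * B"
  defines "k \<equiv> gcd A (gcd B ((a * A + b * B) div d))"
  shows "balanced_perms d a b A B k = three_line_perms d a b A B"
proof (intro subset_antisym subsetI)
  fix p assume p: "p \<in> three_line_perms d a b A B"
  interpret three_line_perm d a b p by (rule three_line_permsD[OF p])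
  obtain css where css: "disjoint_cycle_decomposition p css"
    using permutes_imp_disjoint_cycle_decomposition[OF permutes] by blast
  have AB: "card {j \<in> {0..<d}. [p j = j + a] (mod d)} = A"
    "card {j \<in> {0..<d}. [p j = j + b] (mod d)} = B"
    using p by (simp_all add: three_line_perms_def)
  note type = cycle_type[OF css, unfolded AB, folded k_def]
  have "{j \<in> set cs. [cycle_of_list cs j = j + c] (mod d)} = {j \<in> set cs. [p j = j + c] (mod d)}"
    if "cs \<in> set css" for cs c
    using disjoint_cycle_decomposition_inside[OF css that] by auto
  with css type permutes show "p \<in> balanced_perms d a b A B k"
    unfolding balanced_perms_def by (intro CollectI conjI exI[of _ css]) auto
next
  fix p assume p: "p \<in> balanced_perms d a b A B k"
  then obtain css where perm: "p permutes {0..<d}" and css: "disjoint_cycle_decomposition p css"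
    and len: "length css = k"
    and type: "\<And>cs. cs \<in> set css \<Longrightarrow> length cs = (A + B) div k \<and>
      card {j \<in> set cs. [cycle_of_list cs j = j + a] (mod d)} = A div k \<and>
      card {j \<in> set cs. [cycle_of_list cs j = j + b] (mod d)} = B div k"
    unfolding balanced_perms_def by blast
  have kdvd: "k dvd A" "k dvd B" unfolding k_def by (meson gcd_dvd1 gcd_dvd2 dvd_trans)+
  have "{j \<in> set cs. [cycle_of_list cs j = j + c] (mod d)} = {j \<in> set cs. [p j = j + c] (mod d)}"
    if "cs \<in> set css" for cs c
    using disjoint_cycle_decomposition_inside[OF css that] by auto
  with type kdvd have type: "length cs = A div k + B div k"
    "card {j \<in> set cs. [p j = j + a] (mod d)} = A div k"
    "card {j \<in> set cs. [p j = j + b] (mod d)} = B div k" if "cs \<in> set css" for cs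
    using that by (simp_all add: div_add)
  have steps: "[p i = i + a] (mod d) \<or> [p i = i + b] (mod d)" if "p i \<noteq> i" for i
  proof -
    have "i \<in> set (concat css)"
      using disjoint_cycle_decomposition_outside[OF css, of i] that by blast
    then obtain cs where cs: "cs \<in> set css" "i \<in> set cs" by auto
    let ?U = "{j \<in> set cs. [p j = j + a] (mod d)} \<union> {j \<in> set cs. [p j = j + b] (mod d)}"
    \<comment> \<open>The two classes are disjoint, and \<open>(A + B) div k\<close> splits as
      \<open>A div k + B div k\<close> because \<open>k\<close> divides both numbers.\<close>
    have "card ?U = length cs"
      using type[OF cs(1)] not_cong_add_both[OF a_less_b b_less_d] by (subst card_Un_disjoint) auto
    also have "\<dots> = card (set cs)"
      using disjoint_cycle_decomposition_distinct[OF css cs(1)] by (simp add: distinct_card)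
    finally have "?U = set cs" by (intro card_subset_eq) auto
    with cs(2) show ?thesis by blast
  qed
  interpret three_line_perm d a b p
    using a_pos a_less_b b_less_d coprime perm steps by unfold_locales auto
  have "card {j \<in> {0..<d}. [p j = j + a] (mod d)} = (\<Sum>cs\<leftarrow>css. A div k)"
    using a_pos a_less_b b_less_d type(2)
    by (subst card_steps[OF css]) (auto intro!: arg_cong[of _ _ sum_list])
  moreover have "card {j \<in> {0..<d}. [p j = j + b] (mod d)} = (\<Sum>cs\<leftarrow>css. B div k)"
    using a_pos a_less_b b_less_d type(3)
    by (subst card_steps[OF css]) (auto intro!: arg_cong[of _ _ sum_list])
  ultimately show "p \<in> three_line_perms d a b A B"
    using perm steps kdvd len by (simp add: three_line_perms_def sum_list_triv)
qed

end

section \<open>Nonvanishing, sign and absolute value\<close>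

theorem theorem2p4:
  fixes d a b A B :: nat
  assumes "d \<ge> 3" and "1 \<le> a" and "a < b" and "b \<le> d - 1"
    and "gcd a (gcd b d) = 1"
    and "A + B \<le> d"
  shows "(coeff_xyz (det (Circ d a b)) (d - A - B) A B \<noteq> 0 \<longleftrightarrow> d dvd (a * A + b * B))
    \<and> (d dvd (a * A + b * B) \<longrightarrow>
        (coeff_xyz (det (Circ d a b)) (d - A - B) A B > 0 \<longleftrightarrow>
           even (gcd A (gcd B ((a * A + b * B) div d))) \<or> even (int A + int B - 1))
        \<and> \<bar>coeff_xyz (det (Circ d a b)) (d - A - B) A B\<bar> =
            int (card (balanced_perms d a b A B (gcd A (gcd B ((a * A + b * B) div d))))))"
proof -
  have "b < d" using assms(1,4) by linarith
  note hyps = assms(2,3) this assms(5,6)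
  define k where "k = gcd A (gcd B ((a * A + b * B) div d))"
  define P where "P = three_line_perms d a b A B"
  \<comment> \<open>The exponent does not depend on \<open>p\<close>, so nothing cancels.\<close>
  have "(\<Sum>p\<in>P. sign p) = (\<Sum>p\<in>P. (-1) ^ (A + B + k))"
    unfolding P_def k_def by (intro sum.cong refl sign_three_line_perm[OF hyps])
  then have coeff: "coeff_xyz (det (Circ d a b)) (d - A - B) A B = (-1) ^ (A + B + k) * int (card P)"
    using coeff_det_Circ[OF hyps] by (simp add: P_def)
  have "finite P" unfolding P_def by (rule finite_three_line_perms)
  then have card: "card P > 0 \<longleftrightarrow> d dvd a * A + b * B"
    using three_line_perms_empty_iff[OF hyps] by (auto simp: P_def card_gt_0_iff)
  \<comment> \<open>For even \<open>k\<close> all three summands of \<open>A + B + k\<close> are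
    even; for odd \<open>k\<close> the sum is even exactly when \<open>A + B - 1\<close> is, read
    over the integers so that \<open>A + B = 0\<close> gives -1.\<close>
  have "even k \<Longrightarrow> even A \<and> even B"
    unfolding k_def by (meson dvd_trans gcd_dvd1 gcd_dvd2)
  then have parity: "even (A + B + k) \<longleftrightarrow> even k \<or> even (int A + int B - 1)"
    by auto
  have "coeff_xyz (det (Circ d a b)) (d - A - B) A B > 0 \<longleftrightarrow> even k \<or> even (int A + int B - 1)"
    if "d dvd a * A + b * B"
    using that card unfolding coeff parity[symmetric] by (cases "even (A + B + k)") auto
  moreover have "\<bar>coeff_xyz (det (Circ d a b)) (d - A - B) A B\<bar> = int (card (balanced_perms d a b A B k))"
    if "d dvd a * A + b * B"
    using balanced_perms_eq[OF hyps that] unfolding coeff by (simp add: abs_mult power_abs k_def P_def)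
  ultimately show ?thesis
    using card unfolding coeff k_def[symmetric] by simp
qed

end
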